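(* Let $\{e_k\}_{k=1}^\infty$ be an orthonormal basis for a Hilbert space $\mathbb{H}$ and let $\{\varphi_\ell\}_{\ell=1}^\infty$ be a Riesz basis for $\mathbb{H}$. Let $A=\left(\langle\varphi_\ell,e_k\rangle\right)_{k,\ell=1}^\infty=D+R$ be the cross Gramian, where $D$ is the diagonal of $A$ (so $R=A-D$). If, for a real number $\lambda$, the diagonal entries satisfy $\inf_{i\ge1}|D_{ii}|\ge\lambda$ and $\|R\|\le\frac{\lambda}{2}$, then $\{e_k\}_{k=1}^\infty$ and $\{\varphi_\ell\}_{\ell=1}^\infty$ are woven.
   Context: In the matrix $A$ the row index is $k$ and the column index is $\ell$; $A$, $D$, $R$ are regarded as operators on $\ell^2(\mathbb{N})$ and $\|R\|$ is the operator norm. A family $\{f_i\}_{i\in I}$ in $\mathbb{H}$ is a frame for $\mathbb H$ with lower and upper frame bounds $A',B'$ if $0<A'\le B'<\infty$ and $A'\|x\|^2\le \sum_{i\in I}|\langle x,f_i\rangle|^2\le B'\|x\|^2$ for all $x\in\mathbb{H}$. It is a Riesz basis for $\mathbb{H}$ if its closed span is $\mathbb{H}$ and there are $0<A'\le B'<\infty$ with $A'\sum_{i}|c_i|^2\le\|\sum_{i}c_if_i\|^2\le B'\sum_{i}|c_i|^2$ for all $\{c_i\}\in\ell^2(I)$. Two frames $\{\varphi_i\}_{i=1}^\infty$, $\{\psi_i\}_{i=1}^\infty$ for $\mathbb{H}$ are woven if there are universal constants $0<A'\le B'<\infty$ such that for every $\sigma\subset\mathbb{N}$ (with $\sigma^c=\mathbb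 N\setminus\sigma$) the indexed family $\{\varphi_i\}_{i\in\sigma}\cup\{\psi_i\}_{i\in\sigma^c}$ is a frame for $\mathbb{H}$ with lower and upper frame bounds $A'$ and $B'$. *)

theory Defs
  imports "HOL-Analysis.Analysis"
begin

(* The scalars of a Hilbert space. By the Gelfand-Mazur theorem the only models are the reals
   (with the identity) and the complex numbers (with complex conjugation). *)
class real_or_complex = real_normed_field + banach +
  fixes conjugate :: "'a \<Rightarrow> 'a"
  assumes conjugate_add: "conjugate (x + y) = conjugate x + conjugate y"
    and conjugate_mult: "conjugate (x * y) = conjugate x * conjugate y"
    and conjugate_conjugate: "conjugate (conjugate x) = x"
    and conjugate_scaleR: "conjugate (r *\<^sub>R x) = r *\<^sub>R conjugate x"
    and conjugate_mult_self: "conjugate x * x = (norm x)\<^sup>2 *\<^sub>R 1"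

instantiation real :: real_or_complex
begin
definition "conjugate (x::real) = x"
instance
  by standard (simp_all add: conjugate_real_def power2_eq_square)
end

instantiation complex :: real_or_complex
begin
definition "conjugate (z::complex) = cnj z"
instance
  by standard
    (simp_all add: conjugate_complex_def scaleR_conv_of_real complex_norm_square mult.commute
      del: of_real_power)
end

(* Linearity in the first argument, conjugate-linearity in the second. The norm and the
   completeness of the carrier type come from its type class. *)
locale hilbert_space = vector_space scl
  for scl :: "'k::real_or_complex \<Rightarrow> 'h::banach \<Rightarrow> 'h" +
  fixes ip :: "'h \<Rightarrow> 'h \<Rightarrow> 'k"
  assumes scale_of_real: "scl (of_real r) x = r *\<^sub>R x"
    and ip_add_left: "ip (x + y) z = ip x z + ip y z"
    and ip_scale_left: "ip (scl c x) y = c * ip x y"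
    and ip_commute: "ip y x = conjugate (ip x y)"
    and ip_self: "ip x x = of_real ((norm x)\<^sup>2)"

definition square_summable :: "('i \<Rightarrow> 'k::real_normed_vector) \<Rightarrow> bool" where
  "square_summable c \<longleftrightarrow> (\<lambda>i. (norm (c i))\<^sup>2) summable_on UNIV"

lemma square_summable_zero: "square_summable (\<lambda>i. 0)"
  by (simp add: square_summable_def)

lemma square_summable_L2_set_bound:
  assumes "square_summable c" "finite F"
  shows "L2_set (\<lambda>i. norm (c i)) F \<le> sqrt (\<Sum>\<^sub>\<infinity>i. (norm (c i))\<^sup>2)"
  unfolding L2_set_def
  using assms by (auto intro!: finite_sum_le_infsum simp: square_summable_def)

lemma square_summable_sum_add:
  assumes "square_summable c" "square_summable d" "finite F"
  shows "(\<Sum>i\<in>F. (norm (c i + d i))\<^sup>2)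
    \<le> (sqrt (\<Sum>\<^sub>\<infinity>i. (norm (c i))\<^sup>2) + sqrt (\<Sum>\<^sub>\<infinity>i. (norm (d i))\<^sup>2))\<^sup>2"
proof -
  have "L2_set (\<lambda>i. norm (c i + d i)) F \<le> L2_set (\<lambda>i. norm (c i) + norm (d i)) F"
    by (intro L2_set_mono norm_triangle_ineq) auto
  also have "\<dots> \<le> L2_set (\<lambda>i. norm (c i)) F + L2_set (\<lambda>i. norm (d i)) F"
    by (rule L2_set_triangle_ineq)
  also have "\<dots> \<le> sqrt (\<Sum>\<^sub>\<infinity>i. (norm (c i))\<^sup>2) + sqrt (\<Sum>\<^sub>\<infinity>i. (norm (d i))\<^sup>2)"
    by (intro add_mono square_summable_L2_set_bound assms)
  finally have "(L2_set (\<lambda>i. norm (c i + d i)) F)\<^sup>2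
      \<le> (sqrt (\<Sum>\<^sub>\<infinity>i. (norm (c i))\<^sup>2) + sqrt (\<Sum>\<^sub>\<infinity>i. (norm (d i))\<^sup>2))\<^sup>2"
    by (intro power_mono) auto
  then show ?thesis by (simp add: L2_set_def sum_nonneg)
qed

lemma square_summable_add:
  assumes "square_summable c" "square_summable d"
  shows "square_summable (\<lambda>i. c i + d i)"
  unfolding square_summable_def
proof (rule nonneg_bdd_above_summable_on)
  show "bdd_above (sum (\<lambda>i. (norm (c i + d i))\<^sup>2) ` {F. F \<subseteq> UNIV \<and> finite F})"
    by (rule bdd_aboveI2) (use square_summable_sum_add[OF assms] in blast)
qed simp

lemma square_summable_uminus: "square_summable c \<Longrightarrow> square_summable (\<lambda>i. - c i)"
  by (simp add: square_summable_def)

lemma square_summable_diff: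
  "square_summable c \<Longrightarrow> square_summable d \<Longrightarrow> square_summable (\<lambda>i. c i - d i)"
  using square_summable_add[OF _ square_summable_uminus, of c d] by simp

lemma square_summable_scaleR: "square_summable c \<Longrightarrow> square_summable (\<lambda>i. r *\<^sub>R c i)"
  by (simp add: square_summable_def power_mult_distrib summable_on_cmult_right)

typedef (overloaded) ('i, 'k::real_normed_vector) ell2 =
  "{c :: 'i \<Rightarrow> 'k. square_summable c}" morphisms ell2_nth Abs_ell2
  using square_summable_zero by blast

setup_lifting type_definition_ell2

instantiation ell2 :: (type, real_normed_vector) real_normed_vector
begin

lift_definition zero_ell2 :: "('a, 'b) ell2" is "\<lambda>i. 0"
  by (rule square_summable_zero)
lift_definition plus_ell2 :: "('a, 'b) ell2 \<Rightarrow> ('a, 'b) ell2 \<Rightarrow> ('a, 'b) ell2"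
  is "\<lambda>c d i. c i + d i" by (rule square_summable_add)
lift_definition minus_ell2 :: "('a, 'b) ell2 \<Rightarrow> ('a, 'b) ell2 \<Rightarrow> ('a, 'b) ell2"
  is "\<lambda>c d i. c i - d i" by (rule square_summable_diff)
lift_definition uminus_ell2 :: "('a, 'b) ell2 \<Rightarrow> ('a, 'b) ell2"
  is "\<lambda>c i. - c i" by (rule square_summable_uminus)
lift_definition scaleR_ell2 :: "real \<Rightarrow> ('a, 'b) ell2 \<Rightarrow> ('a, 'b) ell2"
  is "\<lambda>r c i. r *\<^sub>R c i" by (rule square_summable_scaleR)
lift_definition norm_ell2 :: "('a, 'b) ell2 \<Rightarrow> real"
  is "\<lambda>c. sqrt (\<Sum>\<^sub>\<infinity>i. (norm (c i))\<^sup>2)" .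
definition dist_ell2 :: "('a, 'b) ell2 \<Rightarrow> ('a, 'b) ell2 \<Rightarrow> real"
  where "dist_ell2 x y = norm (x - y)"
definition sgn_ell2 :: "('a, 'b) ell2 \<Rightarrow> ('a, 'b) ell2"
  where "sgn_ell2 x = inverse (norm x) *\<^sub>R x"
definition uniformity_ell2 :: "(('a, 'b) ell2 \<times> ('a, 'b) ell2) filter"
  where "uniformity_ell2 = (INF e\<in>{0<..}. principal {(x, y). dist x y < e})"
definition open_ell2 :: "('a, 'b) ell2 set \<Rightarrow> bool"
  where "open_ell2 U = (\<forall>x\<in>U. eventually (\<lambda>(x', y). x' = x \<longrightarrow> y \<in> U) uniformity)"

instance
proof
  fix x y z :: "('a, 'b) ell2" and r s :: real
  show "x + y + z = x + (y + z)" by transfer (simp add: add.assoc)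
  show "x + y = y + x" by transfer (simp add: add.commute)
  show "0 + x = x" by transfer simp
  show "- x + x = 0" by transfer simp
  show "x - y = x + - y" by transfer simp
  show "r *\<^sub>R (x + y) = r *\<^sub>R x + r *\<^sub>R y" by transfer (simp add: scaleR_add_right)
  show "(r + s) *\<^sub>R x = r *\<^sub>R x + s *\<^sub>R x" by transfer (simp add: scaleR_add_left)
  show "r *\<^sub>R s *\<^sub>R x = (r * s) *\<^sub>R x" by transfer simp
  show "1 *\<^sub>R x = x" by transfer simp
  show "dist x y = norm (x - y)" by (rule dist_ell2_def)
  show "sgn x = inverse (norm x) *\<^sub>R x" by (rule sgn_ell2_def)
  show "(norm x = 0) = (x = 0)"
  proof
    assume "norm x = 0"
    then show "x = 0"
    proof transfer
      fix c :: "'a \<Rightarrow> 'b"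
      assume "square_summable c" and "sqrt (\<Sum>\<^sub>\<infinity>i. (norm (c i))\<^sup>2) = 0"
      then have "(norm (c i))\<^sup>2 = 0" for i
        by (intro nonneg_infsum_le_0D[where A=UNIV]) (auto simp: square_summable_def)
      then show "c = (\<lambda>i. 0)" by auto
    qed
  qed (transfer, simp)
  show "norm (x + y) \<le> norm x + norm y"
  proof transfer
    fix c d :: "'a \<Rightarrow> 'b"
    assume cd: "square_summable c" "square_summable d"
    have "(\<Sum>\<^sub>\<infinity>i. (norm (c i + d i))\<^sup>2)
        \<le> (sqrt (\<Sum>\<^sub>\<infinity>i. (norm (c i))\<^sup>2) + sqrt (\<Sum>\<^sub>\<infinity>i. (norm (d i))\<^sup>2))\<^sup>2"
      using square_summable_add[OF cd] square_summable_sum_add[OF cd]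
      by (intro infsum_le_finite_sums) (auto simp: square_summable_def)
    then show "sqrt (\<Sum>\<^sub>\<infinity>i. (norm (c i + d i))\<^sup>2)
        \<le> sqrt (\<Sum>\<^sub>\<infinity>i. (norm (c i))\<^sup>2) + sqrt (\<Sum>\<^sub>\<infinity>i. (norm (d i))\<^sup>2)"
      by (intro real_le_lsqrt add_nonneg_nonneg real_sqrt_ge_zero infsum_nonneg) auto
  qed
  show "norm (r *\<^sub>R x) = \<bar>r\<bar> * norm x"
    by transfer (simp add: power_mult_distrib infsum_cmult_right' real_sqrt_mult)
qed (rule uniformity_ell2_def open_ell2_def)+

end

(* The operator on ell2 given by an infinite matrix. The value is meaningful when the sums
   converge and define a square summable sequence, as they do for every matrix that defines
   a bounded operator. *)
definition matrix_op :: "('i \<Rightarrow> 'i \<Rightarrow> 'k::real_or_complex) \<Rightarrow> ('i, 'k) ell2 \<Rightarrow> ('i, 'k) ell2" where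
  "matrix_op M c = Abs_ell2 (\<lambda>k. \<Sum>\<^sub>\<infinity>l. M k l * ell2_nth c l)"

definition diagonal_part :: "('i \<Rightarrow> 'i \<Rightarrow> 'k::real_or_complex) \<Rightarrow> 'i \<Rightarrow> 'i \<Rightarrow> 'k" where
  "diagonal_part M k l = (if k = l then M k l else 0)"

definition cross_gramian ::
  "('h \<Rightarrow> 'h \<Rightarrow> 'k::real_or_complex) \<Rightarrow> ('i \<Rightarrow> 'h) \<Rightarrow> ('i \<Rightarrow> 'h) \<Rightarrow> 'i \<Rightarrow> 'i \<Rightarrow> 'k" where
  "cross_gramian ip e f k l = ip (f l) (e k)"

definition orthonormal_basis ::
  "('k::real_or_complex \<Rightarrow> 'h::banach \<Rightarrow> 'h) \<Rightarrow> ('h \<Rightarrow> 'h \<Rightarrow> 'k) \<Rightarrow> ('i \<Rightarrow> 'h) \<Rightarrow> bool" where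
  "orthonormal_basis scl ip e \<longleftrightarrow>
     (\<forall>i j. ip (e i) (e j) = (if i = j then 1 else 0)) \<and>
     closure (module.span scl (range e)) = UNIV"

definition riesz_basis ::
  "('k::real_or_complex \<Rightarrow> 'h::banach \<Rightarrow> 'h) \<Rightarrow> ('i \<Rightarrow> 'h) \<Rightarrow> bool" where
  "riesz_basis scl f \<longleftrightarrow>
     closure (module.span scl (range f)) = UNIV \<and>
     (\<exists>a b. 0 < a \<and> a \<le> b \<and>
       (\<forall>c. square_summable c \<longrightarrow>
         (\<lambda>i. scl (c i) (f i)) summable_on UNIV \<and>
         a * (\<Sum>\<^sub>\<infinity>i. (norm (c i))\<^sup>2) \<le> (norm (\<Sum>\<^sub>\<infinity>i. scl (c i) (f i)))\<^sup>2 \<and>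
         (norm (\<Sum>\<^sub>\<infinity>i. scl (c i) (f i)))\<^sup>2 \<le> b * (\<Sum>\<^sub>\<infinity>i. (norm (c i))\<^sup>2)))"

definition frame_with_bounds ::
  "('h::banach \<Rightarrow> 'h \<Rightarrow> 'k::real_or_complex) \<Rightarrow> ('i \<Rightarrow> 'h) \<Rightarrow> real \<Rightarrow> real \<Rightarrow> bool" where
  "frame_with_bounds ip f a b \<longleftrightarrow> 0 < a \<and> a \<le> b \<and>
     (\<forall>x. (\<lambda>i. (norm (ip x (f i)))\<^sup>2) summable_on UNIV \<and>
       a * (norm x)\<^sup>2 \<le> (\<Sum>\<^sub>\<infinity>i. (norm (ip x (f i)))\<^sup>2) \<and>
       (\<Sum>\<^sub>\<infinity>i. (norm (ip x (f i)))\<^sup>2) \<le> b * (norm x)\<^sup>2)"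

definition is_frame :: "('h::banach \<Rightarrow> 'h \<Rightarrow> 'k::real_or_complex) \<Rightarrow> ('i \<Rightarrow> 'h) \<Rightarrow> bool" where
  "is_frame ip f \<longleftrightarrow> (\<exists>a b. frame_with_bounds ip f a b)"

definition woven ::
  "('h::banach \<Rightarrow> 'h \<Rightarrow> 'k::real_or_complex) \<Rightarrow> ('i \<Rightarrow> 'h) \<Rightarrow> ('i \<Rightarrow> 'h) \<Rightarrow> bool" where
  "woven ip f g \<longleftrightarrow> is_frame ip f \<and> is_frame ip g \<and>
     (\<exists>a b. 0 < a \<and> a \<le> b \<and>
       (\<forall>\<sigma>. frame_with_bounds ip (\<lambda>i. if i \<in> \<sigma> then f i else g i) a b))"

end

theory Submission
  imports Defs
begin

text \<open>For a set \<open>\<sigma>\<close> of indices with complement \<open>\<tau>\<close>, split a vector \<open>x\<close> into the parts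
  \<open>u\<close> and \<open>v\<close> that the orthonormal basis \<open>e\<close> spans over \<open>\<sigma>\<close> and \<open>\<tau>\<close>. The inner products
  with the \<open>e\<^sub>k\<close>, \<open>k \<in> \<sigma>\<close>, see all of \<open>u\<close>. Those with the \<open>\<phi>\<^sub>l\<close>, \<open>l \<in> \<tau>\<close>, see enough
  of \<open>v\<close>: if the diagonal entries of the cross Gramian have moduli at least \<open>\<mu> > 0\<close>, then the
  diagonal contributes at least \<open>\<mu> \<parallel>v\<parallel>\<close>, and the off-diagonal part, of norm at most \<open>\<mu>/2\<close>, takes away at most \<open>(\<mu>/2) (\<parallel>u\<parallel> + \<parallel>v\<parallel>)\<close>. What
  remains is \<open>(\<mu>/2) (\<parallel>v\<parallel> - \<parallel>u\<parallel>)\<close>, so if \<open>S\<close> is the square root of the frame sum then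
  \<open>\<parallel>u\<parallel> \<le> S\<close> and \<open>\<parallel>v\<parallel> \<le> \<parallel>u\<parallel> + (2/\<mu>) S\<close>, whence \<open>\<parallel>x\<parallel> \<le> (2 + 2/\<mu>) S\<close> with a
  constant independent of \<open>\<sigma>\<close>. The upper bound is Bessel's inequality for the two families
  separately.

  The estimate for \<open>v\<close> is \<open>finite_section_estimate\<close>. It concerns finite sections of the matrix
  only: adjoints are replaced by a test vector, and the infinite case follows by approximating
  \<open>x\<close> (\<open>weaving_lower_bound\<close>).

  Two points remain. The hypothesis on the operator norm bounds finite sections because the
  operator is bounded to begin with (\<open>matrix_op_off_diagonal_bounded\<close>). And the given
  real number need not be positive: if it is not, the off-diagonal part vanishes, each \<open>\<phi>\<^sub>l\<close> is a
  multiple of \<open>e\<^sub>l\<close>, and the lower Riesz bound keeps the diagonal away from zero, so that the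
  argument applies with another positive constant.\<close>

section \<open>Scalars and inner products\<close>

lemma conjugate_zero [simp]: "conjugate (0 :: 'k::real_or_complex) = 0"
  using conjugate_scaleR[of 0 "0::'k"] by simp

lemma norm_conjugate [simp]: "norm (conjugate c) = norm (c :: 'k::real_or_complex)"
proof (cases "c = 0")
  case False
  have "norm (conjugate c) * norm c = (norm c)\<^sup>2"
    using arg_cong[OF conjugate_mult_self[of c], of norm] by (simp add: norm_mult)
  with False show ?thesis by (simp add: power2_eq_square)
qed simp

lemma conjugate_mult_self_of_real:
  "conjugate c * c = of_real ((norm (c :: 'k::real_or_complex))\<^sup>2)"
  by (simp only: conjugate_mult_self of_real_def)

context hilbert_space
begin

lemma ip_add_right: "ip x (y + z) = ip x y + ip x z"
  by (metis ip_commute ip_add_left conjugate_add)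

lemma ip_scale_right: "ip x (scl c y) = conjugate c * ip x y"
  by (metis ip_commute ip_scale_left conjugate_mult)

lemma ip_zero_left [simp]: "ip 0 y = 0"
  using ip_add_left[of 0 0 y] by simp

lemma ip_zero_right [simp]: "ip x 0 = 0"
  using ip_add_right[of x 0 0] by simp

lemma ip_diff_left: "ip (x - y) z = ip x z - ip y z"
  using ip_add_left[of "x - y" y z] by (simp add: algebra_simps)

lemma ip_diff_right: "ip x (y - z) = ip x y - ip x z"
  using ip_add_right[of x "y - z" z] by (simp add: algebra_simps)

lemma ip_sum_left: "ip (\<Sum>i\<in>F. f i) y = (\<Sum>i\<in>F. ip (f i) y)"
  by (induction F rule: infinite_finite_induct) (auto simp: ip_add_left)

lemma ip_sum_right: "ip x (\<Sum>i\<in>F. f i) = (\<Sum>i\<in>F. ip x (f i))"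
  by (induction F rule: infinite_finite_induct) (auto simp: ip_add_right)

lemma norm_ip_commute: "norm (ip x y) = norm (ip y x)"
  by (metis ip_commute norm_conjugate)

lemma ip_mult_commute: "ip x y * ip y x = of_real ((norm (ip x y))\<^sup>2)"
  using conjugate_mult_self_of_real[of "ip x y"] ip_commute[of y x] by (simp add: mult.commute)

lemma Cauchy_Schwarz: "norm (ip x y) \<le> norm x * norm y"
proof (cases "y = 0")
  case False
  define N where "N = (norm y)\<^sup>2"
  have N: "N > 0" using False by (simp add: N_def)
  have yy: "ip y y = of_real N" by (simp add: ip_self N_def)
  define z where "z = x - scl (ip x y / of_real N) y"
  have zy: "ip z y = 0"
    using N by (simp add: z_def ip_diff_left ip_scale_left yy)
  have "of_real ((norm z)\<^sup>2) = ip z z" by (simp add: ip_self)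
  also have "\<dots> = ip z x"
    by (subst (2) z_def) (simp add: ip_diff_right ip_scale_right zy)
  also have "\<dots> = ip x x - ip x y * ip y x / of_real N"
    by (simp add: z_def ip_diff_left ip_scale_left)
  also have "\<dots> = of_real ((norm x)\<^sup>2 - (norm (ip x y))\<^sup>2 / N)"
    by (simp only: ip_mult_commute ip_self of_real_diff of_real_divide)
  finally have "(norm z)\<^sup>2 = (norm x)\<^sup>2 - (norm (ip x y))\<^sup>2 / N"
    by (simp only: of_real_eq_iff)
  then have "(norm (ip x y))\<^sup>2 / N \<le> (norm x)\<^sup>2"
    using zero_le_power2[of "norm z"] by linarith
  then have "(norm (ip x y))\<^sup>2 \<le> (norm x * norm y)\<^sup>2"
    using N by (simp add: divide_le_eq power_mult_distrib N_def)
  then show ?thesis by (rule power2_le_imp_le) simp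
qed simp

lemma bounded_linear_ip_left: "bounded_linear (\<lambda>x. ip x y)"
proof (rule bounded_linear_intro)
  show "ip (r *\<^sub>R x) y = r *\<^sub>R ip x y" for r x
    by (simp add: scale_of_real[symmetric] ip_scale_left scaleR_conv_of_real)
  show "norm (ip x y) \<le> norm x * norm y" for x
    by (rule Cauchy_Schwarz)
qed (rule ip_add_left)

section \<open>Bessel sequences and orthonormal bases\<close>

text \<open>A synthesis bound dualises to an analysis bound with the same constant: testing against
  the vector whose coefficients are the inner products themselves makes the sum appear on both
  sides of the Cauchy-Schwarz inequality.\<close>
lemma analysis_bound_if_synthesis_bound:
  assumes "b \<ge> 0"
    and syn: "\<And>c. norm (\<Sum>i\<in>F. scl (c i) (f i)) \<le> b * L2_set (\<lambda>i. norm (c i)) F"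
  shows "L2_set (\<lambda>i. norm (ip x (f i))) F \<le> b * norm x"
proof -
  define L where "L = L2_set (\<lambda>i. norm (ip x (f i))) F"
  define w where "w = (\<Sum>i\<in>F. scl (ip x (f i)) (f i))"
  have L0: "L \<ge> 0" by (simp add: L_def L2_set_nonneg)
  have "ip w x = (\<Sum>i\<in>F. ip x (f i) * ip (f i) x)"
    by (simp add: w_def ip_sum_left ip_scale_left)
  also have "\<dots> = of_real (\<Sum>i\<in>F. (norm (ip x (f i)))\<^sup>2)"
    by (simp only: ip_mult_commute of_real_sum)
  also have "(\<Sum>i\<in>F. (norm (ip x (f i)))\<^sup>2) = L\<^sup>2"
    by (simp add: L_def L2_set_def sum_nonneg)
  finally have "L\<^sup>2 = norm (ip w x)" by (simp del: of_real_power)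
  also have "\<dots> \<le> norm w * norm x" by (rule Cauchy_Schwarz)
  also have "\<dots> \<le> b * L * norm x"
    unfolding w_def L_def by (intro mult_right_mono syn) simp
  finally have "L * L \<le> L * (b * norm x)" by (simp add: power2_eq_square mult_ac)
  then have "L \<le> b * norm x"
    using L0 assms(1) by (cases "L = 0") auto
  then show ?thesis by (simp add: L_def)
qed

lemma norm_orthonormal_sum:
  assumes on: "\<And>i j. ip (e i) (e j) = (if i = j then 1 else 0)"
  shows "norm (\<Sum>i\<in>F. scl (c i) (e i)) = L2_set (\<lambda>i. norm (c i)) F"
proof (cases "finite F")
  case True
  have "of_real ((norm (\<Sum>i\<in>F. scl (c i) (e i)))\<^sup>2)
      = ip (\<Sum>i\<in>F. scl (c i) (e i)) (\<Sum>i\<in>F. scl (c i) (e i))"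
    by (simp add: ip_self)
  also have "\<dots> = (\<Sum>i\<in>F. conjugate (c i) * c i)"
    unfolding ip_sum_right
    using True by (intro sum.cong refl)
      (simp add: ip_sum_left ip_scale_left ip_scale_right on if_distrib cong: if_cong)
  also have "\<dots> = of_real (\<Sum>i\<in>F. (norm (c i))\<^sup>2)"
    by (simp only: conjugate_mult_self_of_real of_real_sum)
  finally have "(norm (\<Sum>i\<in>F. scl (c i) (e i)))\<^sup>2 = (\<Sum>i\<in>F. (norm (c i))\<^sup>2)"
    by (simp only: of_real_eq_iff)
  then show ?thesis by (simp add: L2_set_def real_sqrt_unique)
qed simp

lemma Bessel:
  assumes "\<And>i j. ip (e i) (e j) = (if i = j then 1 else 0)"
  shows "L2_set (\<lambda>i. norm (ip x (e i))) F \<le> norm x"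
  using analysis_bound_if_synthesis_bound[where b = 1 and f = e and F = F and x = x]
    norm_orthonormal_sum[OF assms]
  by simp

text \<open>The residual of the orthogonal projection onto finitely many basis vectors is orthogonal
  to their span, hence no longer than the distance of x to any vector of that span.\<close>
lemma orthonormal_basis_approx:
  assumes "orthonormal_basis scl ip e" and "\<epsilon> > 0"
  obtains F where "finite F" "norm (x - (\<Sum>k\<in>F. scl (ip x (e k)) (e k))) < \<epsilon>"
proof -
  have on: "\<And>i j. ip (e i) (e j) = (if i = j then 1 else 0)"
    and dense: "closure (span (range e)) = UNIV"
    using assms(1) by (auto simp: orthonormal_basis_def)
  obtain y where y: "y \<in> span (range e)" "dist y x < \<epsilon>"
    using dense assms(2) by (metis UNIV_I closure_approachable)
  then obtain T r where T: "finite T" "T \<subseteq> range e" "y = (\<Sum>a\<in>T. scl (r a) a)"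
    unfolding span_explicit by blast
  then obtain F where F: "finite F" "T = e ` F"
    by (meson finite_subset_image)
  define z where "z = x - (\<Sum>k\<in>F. scl (ip x (e k)) (e k))"
  have ze: "ip z (e k) = 0" if "k \<in> F" for k
    using that F(1)
    by (simp add: z_def ip_diff_left ip_sum_left ip_scale_left on if_distrib cong: if_cong)
  have zy: "ip z y = 0"
    unfolding T(3) ip_sum_right using F(2) by (auto simp: ip_scale_right ze intro!: sum.neutral)
  have "of_real ((norm z)\<^sup>2) = ip z z" by (simp add: ip_self)
  also have "\<dots> = ip z (x - y)"
    by (subst (2) z_def)
      (simp add: ip_diff_right ip_sum_right ip_scale_right ze zy)
  finally have "of_real ((norm z)\<^sup>2) = ip z (x - y)" .
  then have "(norm z)\<^sup>2 = norm (ip z (x - y))"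
    by (metis norm_of_real abs_of_nonneg zero_le_power2)
  also have "\<dots> \<le> norm z * norm (x - y)" by (rule Cauchy_Schwarz)
  finally have "norm z \<le> norm (x - y)"
    by (cases "z = 0") (auto simp: power2_eq_square)
  also have "\<dots> < \<epsilon>" using y(2) by (simp add: dist_norm norm_minus_commute)
  finally show thesis using that F(1) by (simp add: z_def)
qed

section \<open>The lower frame bound\<close>

text \<open>This is the quantitative core. With \<open>u\<close> and \<open>v\<close> the parts of \<open>x\<close> on \<open>F - \<tau>\<close> and
  \<open>F \<inter> \<tau>\<close>, the inner products with the \<open>\<phi>\<^sub>l\<close>, \<open>l \<in> \<tau>\<close>, are tested against coefficients
  \<open>c\<close> of the same moduli as those of \<open>v\<close>, with phases chosen to make the diagonal contribute at
  least \<open>\<mu> \<parallel>v\<parallel>\<^sup>2\<close>. The off-diagonal part spoils at most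
  \<open>(\<mu>/2) \<parallel>v\<parallel> \<parallel>u + v\<parallel> \<le> (\<mu>/2) \<parallel>v\<parallel> (\<parallel>u\<parallel> + \<parallel>v\<parallel>)\<close>, and division by \<open>\<parallel>v\<parallel>\<close> leaves
  \<open>(\<mu>/2) (\<parallel>v\<parallel> - \<parallel>u\<parallel>)\<close>. The last term on the right accounts for the part of \<open>x\<close> outside
  \<open>F\<close>.\<close>
lemma finite_section_estimate:
  fixes e \<phi> :: "'i \<Rightarrow> 'h"
  assumes on: "\<And>i j. ip (e i) (e j) = (if i = j then 1 else 0)"
    and "finite F" and "\<mu> > 0"
    and R: "\<And>k l. ip (\<phi> l) (e k) = (if k = l then d l else 0) + R k l"
    and d: "\<And>k. \<mu> \<le> norm (d k)"
    and section_R: "\<And>c. L2_set (\<lambda>k. norm (\<Sum>l\<in>F. R k l * c l)) F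
        \<le> \<mu> / 2 * L2_set (\<lambda>l. norm (c l)) F"
    and "\<beta> \<ge> 0"
    and syn: "\<And>c. norm (\<Sum>l\<in>F. scl (c l) (\<phi> l)) \<le> \<beta> * L2_set (\<lambda>l. norm (c l)) F"
  shows "\<mu> / 2 * (L2_set (\<lambda>k. norm (ip x (e k))) (F \<inter> \<tau>) - L2_set (\<lambda>k. norm (ip x (e k))) (F - \<tau>))
    \<le> L2_set (\<lambda>l. norm (ip x (\<phi> l))) (F \<inter> \<tau>)
        + \<beta> * norm (x - (\<Sum>k\<in>F. scl (ip x (e k)) (e k)))"
proof -
  define X where "X k = ip x (e k)" for k
  define p where "p = (\<Sum>k\<in>F. scl (X k) (e k))"
  define a where "a = L2_set (\<lambda>k. norm (X k)) (F - \<tau>)"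
  define b where "b = L2_set (\<lambda>k. norm (X k)) (F \<inter> \<tau>)"
  define G where "G = L2_set (\<lambda>l. norm (ip x (\<phi> l))) (F \<inter> \<tau>)"
  (* The phase makes d l * c l = norm (d l) * X l, so that the diagonal terms below are
     nonnegative reals. *)
  define c where "c l = (if l \<in> \<tau> then of_real (norm (d l)) / d l * X l else 0)" for l
  define w where "w = (\<Sum>l\<in>F. scl (c l) (\<phi> l))"
  define r where "r k = (\<Sum>l\<in>F. R k l * c l)" for k
  have nonneg: "a \<ge> 0" "b \<ge> 0" "G \<ge> 0" by (auto simp: a_def b_def G_def L2_set_nonneg)
  have d0: "d k \<noteq> 0" for k using d[of k] \<open>\<mu> > 0\<close> by auto
  have norm_c: "norm (c l) = (if l \<in> \<tau> then norm (X l) else 0)" for l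
    using d0[of l] by (simp add: c_def norm_mult norm_divide)
  have L2_c: "L2_set (\<lambda>l. norm (c l)) F = b"
    using \<open>finite F\<close> unfolding b_def L2_set_def norm_c
    by (intro arg_cong[of _ _ sqrt]) (auto intro!: sum.mono_neutral_cong_right split: if_splits)

  have L2_X: "L2_set (\<lambda>k. norm (X k)) F \<le> a + b"
  proof -
    have F_eq: "F = (F - \<tau>) \<union> (F \<inter> \<tau>)" by blast
    have "norm p = norm ((\<Sum>k\<in>F - \<tau>. scl (X k) (e k)) + (\<Sum>k\<in>F \<inter> \<tau>. scl (X k) (e k)))"
      unfolding p_def using \<open>finite F\<close>
      by (subst F_eq, subst sum.union_disjoint) auto
    also have "\<dots> \<le> a + b"
      unfolding a_def b_def norm_orthonormal_sum[OF on, symmetric] by (rule norm_triangle_ineq)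
    finally show ?thesis by (simp add: p_def norm_orthonormal_sum[OF on])
  qed

  have we: "ip w (e k) = d k * c k + r k" if "k \<in> F" for k
  proof -
    have "ip w (e k) = (\<Sum>l\<in>F. (if k = l then d l * c l else 0) + R k l * c l)"
      unfolding w_def ip_sum_left by (intro sum.cong) (auto simp: ip_scale_left R algebra_simps)
    then show ?thesis
      using that \<open>finite F\<close> by (simp add: sum.distrib r_def)
  qed
  have "ip w p = (\<Sum>k\<in>F. conjugate (X k) * (d k * c k + r k))"
    by (simp add: p_def ip_sum_right ip_scale_right we)
  also have "\<dots> = (\<Sum>k\<in>F. conjugate (X k) * (d k * c k)) + (\<Sum>k\<in>F. conjugate (X k) * r k)"
    by (simp add: distrib_left sum.distrib)
  also have "(\<Sum>k\<in>F. conjugate (X k) * (d k * c k))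
      = (\<Sum>k\<in>F \<inter> \<tau>. of_real (norm (d k) * (norm (X k))\<^sup>2))"
  proof (rule sum.mono_neutral_cong_right)
    show "conjugate (X k) * (d k * c k) = of_real (norm (d k) * (norm (X k))\<^sup>2)"
      if "k \<in> F \<inter> \<tau>" for k
    proof -
      have "conjugate (X k) * (d k * c k) = of_real (norm (d k)) * (conjugate (X k) * X k)"
        using that d0[of k] by (simp add: c_def)
      then show ?thesis by (simp only: conjugate_mult_self_of_real of_real_mult)
    qed
  qed (auto simp: c_def \<open>finite F\<close>)
  finally have ip_w: "ip w p = of_real (\<Sum>k\<in>F \<inter> \<tau>. norm (d k) * (norm (X k))\<^sup>2)
      + (\<Sum>k\<in>F. conjugate (X k) * r k)"
    by (simp only: of_real_sum)

  have "\<mu> * b\<^sup>2 = (\<Sum>k\<in>F \<inter> \<tau>. \<mu> * (norm (X k))\<^sup>2)"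
    by (simp add: b_def L2_set_def sum_nonneg sum_distrib_left)
  also have "\<dots> \<le> (\<Sum>k\<in>F \<inter> \<tau>. norm (d k) * (norm (X k))\<^sup>2)"
    by (intro sum_mono mult_right_mono d) auto
  also have "\<dots> = norm (of_real (\<Sum>k\<in>F \<inter> \<tau>. norm (d k) * (norm (X k))\<^sup>2) :: 'k)"
    by (simp add: sum_nonneg del: of_real_sum)
  also have "\<dots> = norm (ip w p - (\<Sum>k\<in>F. conjugate (X k) * r k))"
    unfolding ip_w by simp
  also have "\<dots> \<le> norm (ip w p) + norm (\<Sum>k\<in>F. conjugate (X k) * r k)"
    by (rule norm_triangle_ineq4)
  finally have diag: "\<mu> * b\<^sup>2 \<le> norm (ip w p) + norm (\<Sum>k\<in>F. conjugate (X k) * r k)" .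

  have "norm (\<Sum>k\<in>F. conjugate (X k) * r k) \<le> (\<Sum>k\<in>F. \<bar>norm (X k)\<bar> * \<bar>norm (r k)\<bar>)"
    by (rule order_trans[OF norm_sum]) (simp add: norm_mult)
  also have "\<dots> \<le> L2_set (\<lambda>k. norm (X k)) F * L2_set (\<lambda>k. norm (r k)) F"
    by (rule L2_set_mult_ineq)
  also have "\<dots> \<le> (a + b) * (\<mu> / 2 * b)"
    using L2_X section_R[of c] nonneg unfolding L2_c r_def
    by (intro mult_mono) (auto simp: L2_set_nonneg)
  finally have off_diag: "norm (\<Sum>k\<in>F. conjugate (X k) * r k) \<le> (a + b) * (\<mu> / 2 * b)" .

  have "ip w x = (\<Sum>l\<in>F. c l * ip (\<phi> l) x)"
    by (simp add: w_def ip_sum_left ip_scale_left)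
  also have "\<dots> = (\<Sum>l\<in>F \<inter> \<tau>. c l * ip (\<phi> l) x)"
    using \<open>finite F\<close> by (intro sum.mono_neutral_right) (auto simp: c_def)
  finally have "norm (ip w x) \<le> (\<Sum>l\<in>F \<inter> \<tau>. \<bar>norm (X l)\<bar> * \<bar>norm (ip x (\<phi> l))\<bar>)"
    by (auto intro!: order_trans[OF norm_sum] sum_mono
        simp: norm_mult norm_c norm_ip_commute[of _ x])
  also have "\<dots> \<le> b * G" unfolding b_def G_def by (rule L2_set_mult_ineq)
  finally have wx: "norm (ip w x) \<le> b * G" .

  have "norm (ip w (x - p)) \<le> norm w * norm (x - p)" by (rule Cauchy_Schwarz)
  also have "\<dots> \<le> \<beta> * b * norm (x - p)"
    using syn[of c] by (intro mult_right_mono) (simp_all add: w_def L2_c)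
  finally have "norm (ip w (x - p)) \<le> \<beta> * b * norm (x - p)" .
  moreover have "norm (ip w p) \<le> norm (ip w x) + norm (ip w (x - p))"
    using norm_triangle_ineq4[of "ip w x" "ip w (x - p)"] by (simp add: ip_diff_right)
  ultimately have "\<mu> * b\<^sup>2 \<le> b * G + \<beta> * b * norm (x - p) + (a + b) * (\<mu> / 2 * b)"
    using diag off_diag wx by linarith
  then have "b * (\<mu> / 2 * (b - a)) \<le> b * (G + \<beta> * norm (x - p))"
    by (simp add: field_simps power2_eq_square)
  then have "\<mu> / 2 * (b - a) \<le> G + \<beta> * norm (x - p)"
  proof (cases "b = 0")
    case True
    have "0 \<le> \<mu> / 2 * a" "0 \<le> \<beta> * norm (x - p)"
      using nonneg \<open>\<mu> > 0\<close> \<open>\<beta> \<ge> 0\<close> by simp_all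
    with True nonneg show ?thesis by simp
  next
    case False
    with nonneg have "b > 0" by simp
    with \<open>b * (\<mu> / 2 * (b - a)) \<le> _\<close> show ?thesis by (simp only: mult_le_cancel_left_pos)
  qed
  then show ?thesis by (simp add: a_def b_def G_def p_def X_def)
qed

text \<open>The finite-section estimate is applied with \<open>\<tau> = - \<sigma>\<close> to an index set that captures \<open>x\<close> up to
  a small remainder, which contributes a fixed multiple \<open>C\<close> of its norm and so disappears in the
  limit.\<close>
lemma weaving_lower_bound:
  fixes e \<phi> :: "'i \<Rightarrow> 'h"
  assumes basis: "orthonormal_basis scl ip e" and "\<mu> > 0"
    and R: "\<And>k l. ip (\<phi> l) (e k) = (if k = l then d l else 0) + R k l"
    and d: "\<And>k. \<mu> \<le> norm (d k)"
    and section_R: "\<And>F c. finite F \<Longrightarrow> L2_set (\<lambda>k. norm (\<Sum>l\<in>F. R k l * c l)) F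
        \<le> \<mu> / 2 * L2_set (\<lambda>l. norm (c l)) F"
    and "\<beta> \<ge> 0"
    and syn: "\<And>F c. finite F \<Longrightarrow>
        norm (\<Sum>l\<in>F. scl (c l) (\<phi> l)) \<le> \<beta> * L2_set (\<lambda>l. norm (c l)) F"
    and sum: "(\<lambda>i. (norm (ip x (if i \<in> \<sigma> then e i else \<phi> i)))\<^sup>2) summable_on UNIV"
  shows "norm x \<le> (2 + 2 / \<mu>)
    * sqrt (\<Sum>\<^sub>\<infinity>i. (norm (ip x (if i \<in> \<sigma> then e i else \<phi> i)))\<^sup>2)"
proof -
  define f where "f i = (if i \<in> \<sigma> then e i else \<phi> i)" for i
  define S where "S = sqrt (\<Sum>\<^sub>\<infinity>i. (norm (ip x (f i)))\<^sup>2)"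
  have on: "\<And>i j. ip (e i) (e j) = (if i = j then 1 else 0)"
    using basis by (auto simp: orthonormal_basis_def)
  have S: "L2_set (\<lambda>i. norm (ip x (f i))) F \<le> S" if "finite F" for F
    unfolding L2_set_def S_def using sum that
    by (auto intro!: finite_sum_le_infsum simp: f_def)
  define C where "C = 1 + 2 / \<mu> * \<beta>"
  have C: "C > 0" using \<open>\<mu> > 0\<close> \<open>\<beta> \<ge> 0\<close> by (simp add: C_def add_pos_nonneg)
  have "norm x \<le> (2 + 2 / \<mu>) * S + \<delta>" if "\<delta> > 0" for \<delta>
  proof -
    have "\<delta> / C > 0" using C that by simp
    then obtain F where F: "finite F" "norm (x - (\<Sum>k\<in>F. scl (ip x (e k)) (e k))) < \<delta> / C"
      using orthonormal_basis_approx[OF basis] by metis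
    define z where "z = x - (\<Sum>k\<in>F. scl (ip x (e k)) (e k))"
    define u where "u = (\<Sum>k\<in>F - (- \<sigma>). scl (ip x (e k)) (e k))"
    define v where "v = (\<Sum>k\<in>F \<inter> - \<sigma>. scl (ip x (e k)) (e k))"
    have "norm u = L2_set (\<lambda>k. norm (ip x (f k))) (F - (- \<sigma>))"
      unfolding u_def norm_orthonormal_sum[OF on] by (intro L2_set_cong) (auto simp: f_def)
    then have u: "norm u \<le> S" using S F(1) by simp
    have "L2_set (\<lambda>l. norm (ip x (\<phi> l))) (F \<inter> - \<sigma>)
        = L2_set (\<lambda>l. norm (ip x (f l))) (F \<inter> - \<sigma>)"
      by (intro L2_set_cong) (auto simp: f_def)
    then have G: "L2_set (\<lambda>l. norm (ip x (\<phi> l))) (F \<inter> - \<sigma>) \<le> S" using S F(1) by simp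
    have "\<mu> / 2 * (norm v - norm u) \<le> S + \<beta> * norm z"
      using finite_section_estimate[OF on F(1) \<open>\<mu> > 0\<close> R d section_R[OF F(1)] \<open>\<beta> \<ge> 0\<close> syn[OF F(1)],
          where x = x and \<tau> = "- \<sigma>"] G
      unfolding u_def v_def z_def norm_orthonormal_sum[OF on] by linarith
    then have "norm v - norm u \<le> 2 / \<mu> * (S + \<beta> * norm z)"
      using \<open>\<mu> > 0\<close> by (simp add: field_simps)
    moreover have "norm x \<le> norm u + norm v + norm z"
    proof -
      have "(\<Sum>k\<in>F. scl (ip x (e k)) (e k)) = u + v"
        unfolding u_def v_def using F(1)
        by (subst sum.union_disjoint[symmetric]) (auto intro!: sum.cong)
      then have "x = u + v + z" by (simp add: z_def)
      then show ?thesis by (metis norm_triangle_le add_right_mono norm_triangle_ineq)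
    qed
    ultimately have "norm x \<le> 2 * S + 2 / \<mu> * (S + \<beta> * norm z) + norm z"
      using u by linarith
    also have "\<dots> = (2 + 2 / \<mu>) * S + C * norm z"
      by (simp add: C_def algebra_simps)
    also have "C * norm z \<le> \<delta>"
      using F(2) C by (simp add: z_def field_simps)
    finally show ?thesis by simp
  qed
  then have "norm x \<le> (2 + 2 / \<mu>) * S" by (rule field_le_epsilon)
  then show ?thesis by (simp add: S_def f_def)
qed

lemma weaving_upper_bound:
  assumes on: "\<And>i j. ip (e i) (e j) = (if i = j then 1 else 0)"
    and "\<beta> \<ge> 0"
    and syn: "\<And>F c. finite F \<Longrightarrow>
        norm (\<Sum>l\<in>F. scl (c l) (\<phi> l)) \<le> \<beta> * L2_set (\<lambda>l. norm (c l)) F"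
    and "finite F"
  shows "(\<Sum>i\<in>F. (norm (ip x (if i \<in> \<sigma> then e i else \<phi> i)))\<^sup>2) \<le> (1 + \<beta>\<^sup>2) * (norm x)\<^sup>2"
proof -
  have "L2_set (\<lambda>i. norm (ip x (e i))) F \<le> norm x"
    by (rule Bessel[OF on])
  then have e: "(\<Sum>i\<in>F. (norm (ip x (e i)))\<^sup>2) \<le> (norm x)\<^sup>2"
    unfolding L2_set_def by (simp add: real_sqrt_le_iff' sum_nonneg)
  have "L2_set (\<lambda>i. norm (ip x (\<phi> i))) F \<le> \<beta> * norm x"
    using syn \<open>finite F\<close> \<open>\<beta> \<ge> 0\<close> by (intro analysis_bound_if_synthesis_bound) auto
  then have \<phi>: "(\<Sum>i\<in>F. (norm (ip x (\<phi> i)))\<^sup>2) \<le> (\<beta> * norm x)\<^sup>2"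
    unfolding L2_set_def using \<open>\<beta> \<ge> 0\<close> by (simp add: real_sqrt_le_iff' sum_nonneg)
  have "(\<Sum>i\<in>F. (norm (ip x (if i \<in> \<sigma> then e i else \<phi> i)))\<^sup>2)
      \<le> (\<Sum>i\<in>F. (norm (ip x (e i)))\<^sup>2 + (norm (ip x (\<phi> i)))\<^sup>2)"
    by (intro sum_mono) auto
  also have "\<dots> \<le> (norm x)\<^sup>2 + (\<beta> * norm x)\<^sup>2"
    unfolding sum.distrib using e \<phi> by (rule add_mono)
  finally show ?thesis by (simp add: power_mult_distrib algebra_simps)
qed

lemma woven_if_diagonally_dominant:
  fixes e \<phi> :: "'i \<Rightarrow> 'h"
  assumes basis: "orthonormal_basis scl ip e" and "\<mu> > 0"
    and R: "\<And>k l. ip (\<phi> l) (e k) = (if k = l then d l else 0) + R k l"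
    and d: "\<And>k. \<mu> \<le> norm (d k)"
    and section_R: "\<And>F c. finite F \<Longrightarrow> L2_set (\<lambda>k. norm (\<Sum>l\<in>F. R k l * c l)) F
        \<le> \<mu> / 2 * L2_set (\<lambda>l. norm (c l)) F"
    and "\<beta> \<ge> 0"
    and syn: "\<And>F c. finite F \<Longrightarrow>
        norm (\<Sum>l\<in>F. scl (c l) (\<phi> l)) \<le> \<beta> * L2_set (\<lambda>l. norm (c l)) F"
  shows "woven ip e \<phi>"
proof -
  have on: "\<And>i j. ip (e i) (e j) = (if i = j then 1 else 0)"
    using basis by (auto simp: orthonormal_basis_def)
  define A' where "A' = inverse ((2 + 2 / \<mu>)\<^sup>2)"
  have C: "2 + 2 / \<mu> > 0" "(2 + 2 / \<mu>)\<^sup>2 > 1"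
    using \<open>\<mu> > 0\<close> by (auto simp: add_pos_pos one_less_power)
  have A': "A' > 0" "A' \<le> 1 + \<beta>\<^sup>2"
  proof -
    show "A' > 0" using C by (simp add: A'_def)
    have "A' \<le> 1" using C unfolding A'_def by (intro inverse_le_1_iff[THEN iffD2]) simp
    then show "A' \<le> 1 + \<beta>\<^sup>2" using zero_le_power2[of \<beta>] by linarith
  qed
  have fr: "frame_with_bounds ip (\<lambda>i. if i \<in> \<sigma> then e i else \<phi> i) A' (1 + \<beta>\<^sup>2)" for \<sigma>
    unfolding frame_with_bounds_def
  proof (intro conjI allI A')
    fix x
    let ?g = "\<lambda>i. (norm (ip x (if i \<in> \<sigma> then e i else \<phi> i)))\<^sup>2"
    have upper: "sum ?g F \<le> (1 + \<beta>\<^sup>2) * (norm x)\<^sup>2" if "finite F" for F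
      by (rule weaving_upper_bound) (use that on \<open>\<beta> \<ge> 0\<close> syn in auto)
    show sum: "?g summable_on UNIV"
      by (rule nonneg_bdd_above_summable_on) (auto intro!: bdd_aboveI2 upper)
    show "infsum ?g UNIV \<le> (1 + \<beta>\<^sup>2) * (norm x)\<^sup>2"
      by (intro infsum_le_finite_sums sum upper)
    have "(norm x)\<^sup>2 \<le> ((2 + 2 / \<mu>) * sqrt (infsum ?g UNIV))\<^sup>2"
      using weaving_lower_bound[OF basis \<open>\<mu> > 0\<close> R d section_R \<open>\<beta> \<ge> 0\<close> syn sum]
      by (intro power_mono) auto
    also have "\<dots> = (2 + 2 / \<mu>)\<^sup>2 * infsum ?g UNIV"
      by (simp add: power_mult_distrib infsum_nonneg)
    finally show "A' * (norm x)\<^sup>2 \<le> infsum ?g UNIV"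
      using C by (simp add: A'_def field_simps)
  qed
  from fr[of UNIV] fr[of "{}"] fr A' show ?thesis
    unfolding woven_def is_frame_def by auto
qed

end

section \<open>Boundedness of the matrix operator\<close>

lemma ell2_nth_square_summable: "square_summable (ell2_nth c)"
  using ell2_nth[of c] by simp

lemma norm_Abs_ell2_le:
  assumes "\<And>F. finite F \<Longrightarrow> L2_set (\<lambda>i. norm (g i)) F \<le> K"
  shows "square_summable g" "norm (Abs_ell2 g) \<le> K"
proof -
  have K: "K \<ge> 0" using assms[of "{}"] by simp
  have le: "(\<Sum>i\<in>F. (norm (g i))\<^sup>2) \<le> K\<^sup>2" if "finite F" for F
    using assms[OF that] K unfolding L2_set_def by (simp add: real_sqrt_le_iff' sum_nonneg)
  show *: "square_summable g"
    unfolding square_summable_def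
    by (rule nonneg_bdd_above_summable_on) (auto intro!: bdd_aboveI2 le)
  have "(\<Sum>\<^sub>\<infinity>i. (norm (g i))\<^sup>2) \<le> K\<^sup>2"
    using * le by (intro infsum_le_finite_sums) (auto simp: square_summable_def)
  then show "norm (Abs_ell2 g) \<le> K"
    using * K by (simp add: norm_ell2.rep_eq Abs_ell2_inverse real_le_lsqrt infsum_nonneg)
qed

lemma L2_set_ell2_nth_le: "finite F \<Longrightarrow> L2_set (\<lambda>i. norm (ell2_nth c i)) F \<le> norm c"
  using square_summable_L2_set_bound[OF ell2_nth_square_summable] by (simp add: norm_ell2.rep_eq)

lemma norm_le_onorm_mult:
  fixes f :: "'a::real_normed_vector \<Rightarrow> 'b::real_normed_vector"
  assumes "\<And>x. norm (f x) \<le> K * norm x"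
  shows "norm (f x) \<le> onorm f * norm x" "onorm f \<ge> 0"
proof -
  have bdd: "bdd_above (range (\<lambda>x. norm (f x) / norm x))"
  proof (rule bdd_aboveI2)
    show "norm (f x) / norm x \<le> max K 0" for x
      using assms[of x] by (cases "x = 0") (auto simp: divide_le_eq intro: order_trans mult_right_mono)
  qed
  have le: "norm (f x) / norm x \<le> onorm f" for x
    unfolding onorm_def by (rule cSUP_upper[OF _ bdd]) simp
  show "norm (f x) \<le> onorm f * norm x"
    using le[of x] assms[of x] by (cases "x = 0") (auto simp: divide_le_eq)
  show "onorm f \<ge> 0" using le[of 0] by simp
qed

context hilbert_space
begin

lemma riesz_basis_finite_sum_bounds:
  fixes f :: "'i \<Rightarrow> 'h"
  assumes "riesz_basis scl f"
  obtains a b where "a > 0" "b > 0"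
    and "\<And>F c. finite F \<Longrightarrow> norm (\<Sum>l\<in>F. scl (c l) (f l)) \<le> b * L2_set (\<lambda>l. norm (c l)) F"
    and "\<And>l. a \<le> norm (f l)"
    and "\<And>c. square_summable c \<Longrightarrow> (\<lambda>l. scl (c l) (f l)) summable_on UNIV"
    and "\<And>c. square_summable c \<Longrightarrow>
      norm (\<Sum>\<^sub>\<infinity>l. scl (c l) (f l)) \<le> b * norm (Abs_ell2 c)"
proof -
  obtain a b where ab: "0 < a" "a \<le> b" and
    *: "\<And>c. square_summable c \<Longrightarrow>
         (\<lambda>i. scl (c i) (f i)) summable_on UNIV \<and>
         a * (\<Sum>\<^sub>\<infinity>i. (norm (c i))\<^sup>2) \<le> (norm (\<Sum>\<^sub>\<infinity>i. scl (c i) (f i)))\<^sup>2 \<and>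
         (norm (\<Sum>\<^sub>\<infinity>i. scl (c i) (f i)))\<^sup>2 \<le> b * (\<Sum>\<^sub>\<infinity>i. (norm (c i))\<^sup>2)"
    using assms unfolding riesz_basis_def by blast
  have fin: "a * (\<Sum>l\<in>F. (norm (c l))\<^sup>2) \<le> (norm (\<Sum>l\<in>F. scl (c l) (f l)))\<^sup>2 \<and>
      (norm (\<Sum>l\<in>F. scl (c l) (f l)))\<^sup>2 \<le> b * (\<Sum>l\<in>F. (norm (c l))\<^sup>2)"
    if "finite F" for F and c :: "'i \<Rightarrow> 'k"
  proof -
    let ?c = "\<lambda>l. if l \<in> F then c l else 0"
    have 1: "((\<lambda>l. (norm (?c l))\<^sup>2) has_sum (\<Sum>l\<in>F. (norm (c l))\<^sup>2)) UNIV"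
      using that by (intro has_sum_finite_neutralI[of F]) auto
    have 2: "((\<lambda>l. scl (?c l) (f l)) has_sum (\<Sum>l\<in>F. scl (c l) (f l))) UNIV"
      using that by (intro has_sum_finite_neutralI[of F]) auto
    have "square_summable ?c"
      using 1 unfolding square_summable_def by (rule has_sum_imp_summable)
    from *[OF this] show ?thesis
      by (simp only: infsumI[OF 1] infsumI[OF 2])
  qed
  show thesis
  proof (rule that[of "sqrt a" "sqrt b"])
    show "norm (\<Sum>l\<in>F. scl (c l) (f l)) \<le> sqrt b * L2_set (\<lambda>l. norm (c l)) F"
      if "finite F" for F and c :: "'i \<Rightarrow> 'k"
      using fin[OF that, of c] by (simp add: L2_set_def real_le_rsqrt flip: real_sqrt_mult)
    show "sqrt a \<le> norm (f l)" for l
      using fin[of "{l}" "\<lambda>_. 1"] by (simp add: real_le_lsqrt)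
    fix c :: "'i \<Rightarrow> 'k" assume c: "square_summable c"
    show "(\<lambda>l. scl (c l) (f l)) summable_on UNIV" using *[OF c] by blast
    show "norm (\<Sum>\<^sub>\<infinity>l. scl (c l) (f l)) \<le> sqrt b * norm (Abs_ell2 c)"
      using *[OF c] c
      by (simp add: norm_ell2.rep_eq Abs_ell2_inverse real_le_rsqrt flip: real_sqrt_mult)
  qed (use ab in auto)
qed

text \<open>The supremum defining the operator norm carries information only for an operator that is
  known to be bounded. The cross Gramian is the synthesis operator of \<open>\<phi>\<close> followed by the analysis
  operator of \<open>e\<close>, both bounded, and its diagonal entries are bounded because the norms of the
  \<open>\<phi>\<^sub>l\<close> are.\<close>
lemma matrix_op_off_diagonal_bounded:
  fixes e \<phi> :: "'i \<Rightarrow> 'h"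
  assumes on: "\<And>i j. ip (e i) (e j) = (if i = j then 1 else 0)"
    and "riesz_basis scl \<phi>"
    and R: "R = (\<lambda>k l. cross_gramian ip e \<phi> k l - diagonal_part (cross_gramian ip e \<phi>) k l)"
  obtains K where "\<And>c. norm (matrix_op R c) \<le> K * norm c"
    and "\<And>c k. ell2_nth (matrix_op R c) k = (\<Sum>\<^sub>\<infinity>l. R k l * ell2_nth c l)"
proof -
  obtain a b where "a > 0" and b: "b > 0"
    and syn: "\<And>F c. finite F \<Longrightarrow>
      norm (\<Sum>l\<in>F. scl (c l) (\<phi> l)) \<le> b * L2_set (\<lambda>l. norm (c l)) F"
    and "\<And>l. a \<le> norm (\<phi> l)"
    and summable: "\<And>c. square_summable c \<Longrightarrow> (\<lambda>l. scl (c l) (\<phi> l)) summable_on UNIV"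
    and syn_inf: "\<And>c. square_summable c \<Longrightarrow>
      norm (\<Sum>\<^sub>\<infinity>l. scl (c l) (\<phi> l)) \<le> b * norm (Abs_ell2 c)"
    by (rule riesz_basis_finite_sum_bounds[OF assms(2)]) (rule that; assumption)
  define d where "d k = ip (\<phi> k) (e k)" for k
  have d: "norm (d k) \<le> b" for k
  proof -
    have "norm (d k) \<le> norm (\<phi> k) * norm (e k)" unfolding d_def by (rule Cauchy_Schwarz)
    also have "norm (e k) = 1" using norm_orthonormal_sum[OF on, of "\<lambda>_. 1" "{k}"] by simp
    also have "norm (\<phi> k) * 1 \<le> b" using syn[of "{k}" "\<lambda>_. 1"] by simp
    finally show ?thesis .
  qed
  have main: "norm (matrix_op R c) \<le> (b + b) * norm c \<and>
      (\<forall>k. ell2_nth (matrix_op R c) k = (\<Sum>\<^sub>\<infinity>l. R k l * ell2_nth c l))" for c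
  proof -
    define w where "w = (\<Sum>\<^sub>\<infinity>l. scl (ell2_nth c l) (\<phi> l))"
    have w: "((\<lambda>l. scl (ell2_nth c l) (\<phi> l)) has_sum w) UNIV"
      unfolding w_def by (intro has_sum_infsum summable ell2_nth_square_summable)
    have norm_w: "norm w \<le> b * norm c"
      using syn_inf[OF ell2_nth_square_summable, of c] by (simp add: w_def ell2_nth_inverse)
    have row: "(\<Sum>\<^sub>\<infinity>l. R k l * ell2_nth c l) = ip w (e k) - d k * ell2_nth c k" for k
    proof (rule infsumI)
      have "((\<lambda>l. ip (scl (ell2_nth c l) (\<phi> l)) (e k)) has_sum ip w (e k)) UNIV"
        using has_sum_bounded_linear[OF bounded_linear_ip_left w] by (simp add: o_def)
      moreover have "((\<lambda>l. if l = k then - (d k * ell2_nth c k) else 0)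
          has_sum - (d k * ell2_nth c k)) UNIV"
        by (intro has_sum_finite_neutralI[of "{k}"]) auto
      ultimately have "((\<lambda>l. ip (scl (ell2_nth c l) (\<phi> l)) (e k)
          + (if l = k then - (d k * ell2_nth c k) else 0))
          has_sum ip w (e k) + - (d k * ell2_nth c k)) UNIV"
        by (rule has_sum_add)
      then have "((\<lambda>l. R k l * ell2_nth c l) has_sum ip w (e k) + - (d k * ell2_nth c k)) UNIV"
        by (rule has_sum_cong[THEN iffD1, rotated])
          (auto simp: R cross_gramian_def diagonal_part_def d_def ip_scale_left algebra_simps)
      then show "((\<lambda>l. R k l * ell2_nth c l) has_sum ip w (e k) - d k * ell2_nth c k) UNIV"
        by simp
    qed
    have 1: "L2_set (\<lambda>k. norm (ip w (e k))) F \<le> b * norm c" for F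
      using Bessel[OF on, of w F] norm_w by linarith
    have 2: "L2_set (\<lambda>k. norm (d k * ell2_nth c k)) F \<le> b * norm c" if "finite F" for F
    proof -
      have "L2_set (\<lambda>k. norm (d k * ell2_nth c k)) F \<le> L2_set (\<lambda>k. b * norm (ell2_nth c k)) F"
        by (intro L2_set_mono) (auto simp: norm_mult intro!: mult_right_mono d)
      also have "\<dots> = b * L2_set (\<lambda>k. norm (ell2_nth c k)) F"
        using b by (simp add: L2_set_right_distrib)
      also have "\<dots> \<le> b * norm c"
        using b L2_set_ell2_nth_le[OF that] by (intro mult_left_mono) auto
      finally show ?thesis .
    qed
    note sq = norm_Abs_ell2_le(1)[OF 1] norm_Abs_ell2_le(1)[OF 2]
    have op: "matrix_op R c = Abs_ell2 (\<lambda>k. ip w (e k)) - Abs_ell2 (\<lambda>k. d k * ell2_nth c k)"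
      unfolding matrix_op_def row using sq
      by (simp add: minus_ell2.abs_eq eq_onp_same_args)
    have "norm (matrix_op R c) \<le> b * norm c + b * norm c"
      unfolding op
      by (rule order_trans[OF norm_triangle_ineq4 add_mono])
        (rule norm_Abs_ell2_le(2)[OF 1] norm_Abs_ell2_le(2)[OF 2]; assumption)+
    moreover have "ell2_nth (matrix_op R c) k = (\<Sum>\<^sub>\<infinity>l. R k l * ell2_nth c l)" for k
      unfolding op minus_ell2.rep_eq row using sq by (simp add: Abs_ell2_inverse)
    ultimately show ?thesis by (simp add: distrib_right)
  qed
  show thesis by (rule that[of "b + b"]) (use main in auto)
qed

lemma finite_section_le_onorm:
  fixes R :: "'i \<Rightarrow> 'i \<Rightarrow> 'k"
  assumes K: "\<And>c. norm (matrix_op R c) \<le> K * norm c"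
    and row: "\<And>c k. ell2_nth (matrix_op R c) k = (\<Sum>\<^sub>\<infinity>l. R k l * ell2_nth c l)"
    and "finite F"
  shows "L2_set (\<lambda>k. norm (\<Sum>l\<in>F. R k l * c l)) F
    \<le> onorm (matrix_op R) * L2_set (\<lambda>l. norm (c l)) F"
proof -
  let ?c = "\<lambda>l. if l \<in> F then c l else 0"
  have 1: "((\<lambda>l. (norm (?c l))\<^sup>2) has_sum (\<Sum>l\<in>F. (norm (c l))\<^sup>2)) UNIV"
    using assms(3) by (intro has_sum_finite_neutralI[of F]) auto
  have sq: "square_summable ?c"
    using 1 unfolding square_summable_def by (rule has_sum_imp_summable)
  have norm_c: "norm (Abs_ell2 ?c) = L2_set (\<lambda>l. norm (c l)) F"
    using sq infsumI[OF 1] by (simp add: norm_ell2.rep_eq Abs_ell2_inverse L2_set_def)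
  have "((\<lambda>l. R k l * ?c l) has_sum (\<Sum>l\<in>F. R k l * c l)) UNIV" for k
    using assms(3) by (intro has_sum_finite_neutralI[of F]) auto
  then have "ell2_nth (matrix_op R (Abs_ell2 ?c)) k = (\<Sum>l\<in>F. R k l * c l)" for k
    unfolding row using sq by (simp add: Abs_ell2_inverse infsumI)
  then have "L2_set (\<lambda>k. norm (\<Sum>l\<in>F. R k l * c l)) F \<le> norm (matrix_op R (Abs_ell2 ?c))"
    using L2_set_ell2_nth_le[OF assms(3), of "matrix_op R (Abs_ell2 ?c)"] by simp
  also have "\<dots> \<le> onorm (matrix_op R) * norm (Abs_ell2 ?c)"
    by (rule norm_le_onorm_mult(1)[OF K])
  finally show ?thesis by (simp add: norm_c)
qed

text \<open>Such a vector is a multiple of \<open>e l\<close>; this transfers the lower Riesz bound to the diagonal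
  of the cross Gramian when the off-diagonal part vanishes.\<close>
lemma norm_le_diagonal_if_off_diagonal_zero:
  assumes "orthonormal_basis scl ip e"
    and off: "\<And>k. k \<noteq> l \<Longrightarrow> ip y (e k) = 0"
  shows "norm y \<le> norm (ip y (e l))"
proof (rule field_le_epsilon)
  fix \<epsilon> :: real assume "\<epsilon> > 0"
  then obtain F where F: "finite F" "norm (y - (\<Sum>k\<in>F. scl (ip y (e k)) (e k))) < \<epsilon>"
    using orthonormal_basis_approx[OF assms(1)] by metis
  have on: "\<And>i j. ip (e i) (e j) = (if i = j then 1 else 0)"
    using assms(1) by (auto simp: orthonormal_basis_def)
  have "norm (\<Sum>k\<in>F. scl (ip y (e k)) (e k)) = L2_set (\<lambda>k. norm (ip y (e k))) F"
    by (rule norm_orthonormal_sum[OF on])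
  also have "\<dots> \<le> L2_set (\<lambda>k. norm (ip y (e k))) (insert l F)"
    using F(1) by (auto simp: L2_set_def intro!: sum_mono2)
  also have "\<dots> = L2_set (\<lambda>k. norm (ip y (e k))) {l}"
    unfolding L2_set_def using F(1) off
    by (intro arg_cong[of _ _ sqrt] sum.mono_neutral_right) auto
  finally have "norm (\<Sum>k\<in>F. scl (ip y (e k)) (e k)) \<le> norm (ip y (e l))" by simp
  moreover have "norm y \<le> norm (\<Sum>k\<in>F. scl (ip y (e k)) (e k))
      + norm (y - (\<Sum>k\<in>F. scl (ip y (e k)) (e k)))"
    by (metis norm_triangle_sub)
  ultimately show "norm y \<le> norm (ip y (e l)) + \<epsilon>" using F(2) by linarith
qed

end

theorem proposition7p1:
  fixes scl :: "'k::real_or_complex \<Rightarrow> 'h::banach \<Rightarrow> 'h"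
    and ip :: "'h \<Rightarrow> 'h \<Rightarrow> 'k"
    and e \<phi> :: "nat \<Rightarrow> 'h"
    and A D R :: "nat \<Rightarrow> nat \<Rightarrow> 'k"
    and lam :: real
  assumes "hilbert_space scl ip"
    and "orthonormal_basis scl ip e"
    and "riesz_basis scl \<phi>"
    and "A = cross_gramian ip e \<phi>"
    and "D = diagonal_part A"
    and "R = (\<lambda>k l. A k l - D k l)"
    and "(INF i. norm (D i i)) \<ge> lam"
    and "onorm (matrix_op R) \<le> lam / 2"
  shows "woven ip e \<phi>"
proof -
  interpret hilbert_space scl ip by fact
  have on: "\<And>i j. ip (e i) (e j) = (if i = j then 1 else 0)"
    using assms(2) by (auto simp: orthonormal_basis_def)
  define d where "d k = ip (\<phi> k) (e k)" for k
  have R: "ip (\<phi> l) (e k) = (if k = l then d l else 0) + R k l" for k l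
    by (simp add: assms(4-6) cross_gramian_def diagonal_part_def d_def)
  have "norm (D k k) \<ge> lam" for k
    by (rule order_trans[OF assms(7) cINF_lower]) (auto intro: bdd_belowI2[of _ 0])
  then have d_lam: "lam \<le> norm (d k)" for k
    by (simp add: assms(4,5) cross_gramian_def diagonal_part_def d_def)
  obtain a b where "a > 0" "b > 0"
    and syn: "\<And>F c. finite F \<Longrightarrow>
      norm (\<Sum>l\<in>F. scl (c l) (\<phi> l)) \<le> b * L2_set (\<lambda>l. norm (c l)) F"
    and a: "\<And>l. a \<le> norm (\<phi> l)"
    using riesz_basis_finite_sum_bounds[OF assms(3)] by metis
  obtain K where K: "\<And>c. norm (matrix_op R c) \<le> K * norm c"
    and row: "\<And>c k. ell2_nth (matrix_op R c) k = (\<Sum>\<^sub>\<infinity>l. R k l * ell2_nth c l)"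
    using matrix_op_off_diagonal_bounded[OF on assms(3), of R] assms(4-6) by metis
  have section_le: "L2_set (\<lambda>k. norm (\<Sum>l\<in>F. R k l * c l)) F
      \<le> onorm (matrix_op R) * L2_set (\<lambda>l. norm (c l)) F" if "finite F" for F c
    by (rule finite_section_le_onorm[OF K row that])
  have onorm_nonneg: "onorm (matrix_op R) \<ge> 0" by (rule norm_le_onorm_mult(2)[OF K])
  obtain \<mu> where \<mu>: "\<mu> > 0" "\<And>k. \<mu> \<le> norm (d k)" "onorm (matrix_op R) \<le> \<mu> / 2"
  proof (cases "lam > 0")
    case True
    then show thesis using that[of lam] d_lam assms(8) by blast
  next
    (* The matrix R vanishes, and the lower Riesz bound a takes the place of lam. *)
    case False
    with assms(8) onorm_nonneg have 0: "onorm (matrix_op R) = 0" by linarith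
    have "R k l = 0" for k l
    proof -
      let ?c = "\<lambda>j. if j = l then 1 else (0 :: 'k)"
      have "norm (R k l) = norm (\<Sum>j\<in>{k, l}. R k j * ?c j)"
        by (simp add: if_distrib cong: if_cong)
      also have "\<dots> \<le> L2_set (\<lambda>i. norm (\<Sum>j\<in>{k, l}. R i j * ?c j)) {k, l}"
        by (rule member_le_L2_set) auto
      also have "\<dots> \<le> onorm (matrix_op R) * L2_set (\<lambda>j. norm (?c j)) {k, l}"
        by (rule section_le) simp
      finally show ?thesis by (simp only: 0 mult_zero_left norm_le_zero_iff)
    qed
    then have "norm (\<phi> l) \<le> norm (d l)" for l
      unfolding d_def
      by (intro norm_le_diagonal_if_off_diagonal_zero[OF assms(2)]) (simp add: R)
    with a have "a \<le> norm (d l)" for l by (meson order_trans)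
    then show thesis using that[of a] \<open>a > 0\<close> 0 by simp
  qed
  have "L2_set (\<lambda>k. norm (\<Sum>l\<in>F. R k l * c l)) F \<le> \<mu> / 2 * L2_set (\<lambda>l. norm (c l)) F"
    if "finite F" for F c
    by (rule order_trans[OF section_le[OF that] mult_right_mono[OF \<mu>(3)]]) (rule L2_set_nonneg)
  then show ?thesis
    using \<open>b > 0\<close> by (intro woven_if_diagonally_dominant[OF assms(2) \<mu>(1) R \<mu>(2) _ _ syn]) auto
qed

end
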